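(* Let $F\colon\mathbb{R}^m\to\mathbb{R}$ be a permutation invariant averaging operator for which there exists $0<\kappa<1$ such that $F(x_1+c',x_2,\dots,x_m)\le F(x_1,\dots,x_m)+c'\kappa$ for all $(x_1,\dots,x_m)\in\mathbb{R}^m$ and all $c'>0$. If $I$ is a subinterval of $[0,1]$ with measure $|I|$, then $$0\le\omega_F(I)\le 2\,(m|I|)^{\gamma}$$ for all $\gamma\le-\log_m(\kappa)$.
   Context: Fix an integer $m\ge 3$. The directed tree $\mathbb{T}_m$ with regular $m$-branching has as vertices the empty sequence $\emptyset$ and all finite sequences $(a_1,\dots,a_k)$, $k\ge1$, with $a_i\in\{0,\dots,m-1\}$. The successors of a vertex $x$ are the $m$ vertices $(x,0),\dots,(x,m-1)$ obtained by appending one coordinate. The boundary $\partial\mathbb{T}_m$ is the set of branches, i.e. infinite sequences $(a_1,a_2,\dots)$ in $\{0,\dots,m-1\}$; a branch is also written $\pi=(x_1,x_2,\dots)$ with $x_k=(a_1,\dots,a_k)$. Let $\psi\colon\partial\mathbb{T}_m\to[0,1]$, $\psi(\pi)=\sum_{k\ge1}a_km^{-k}$. For $I\subset[0,1]$, $\chi_I(\pi)=1$ if $\psi(\pi)\in I$ and $0$ otherwise. An averaging operator is a continuous $F\colon\mathbb{R}^m\to\mathbb{R}$ such that: (i) $F(0,\dots,0)=0$ and $F(1,\dots,1)=1$; (ii) $F(tx_1,\dots,tx_m)=tF(x_1,\dots,x_m)$ for all $t\in\mathbb{R}$; (iii) $F(t+x_1,\dots,t+x_m)=t+F(x_1,\dots,x_m)$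 for all $t\in\mathbb{R}$; (iv) $F(x_1,\dots,x_m)<\max\{x_1,\dots,x_m\}$ if not all $x_j$ are equal; (v) $F$ is nondecreasing in each variable. It is permutation invariant if $F(x_1,\dots,x_m)=F(x_{\tau(1)},\dots,x_{\tau(m)})$ for every permutation $\tau$ of $\{1,\dots,m\}$. A function $w\colon\mathbb{T}_m\to\mathbb{R}$ is $F$-superharmonic if $w(x)\ge F(w(x,0),\dots,w(x,m-1))$ for all $x\in\mathbb{T}_m$. $U_F(0,I,1)$ is the set of all $F$-superharmonic $w$ such that $\liminf_{k\to\infty}w(x_k)\ge\chi_I(\pi)$ for all $\pi=(x_1,x_2,\dots)\in\partial\mathbb{T}_m$. The $F$-harmonic measure of $I$ is $\omega_F(I)=\inf\{w(\emptyset)\colon w\in U_F(0,I,1)\}$.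
   Formalization: The exponent γ is additionally required to be nonnegative (0 ≤ γ ≤ −log_m(κ)); for negative γ the bound fails, e.g. F the arithmetic mean, κ = 1/m, I = [0,1], γ = −1 gives ω_F(I) = 1 > 2/m. *)

theory Defs
  imports "HOL-Analysis.Analysis"
begin

text \<open>
  The space \<open>\<real>\<^sup>m\<close> is the set of functions on \<open>{0, ..., m-1}\<close> (undefined elsewhere) with the
  product topology \<open>powertop_real {..<m}\<close>; the coordinate \<open>x_{i+1}\<close> of the usual notation is \<open>x i\<close>.
\<close>

definition Rm :: "nat \<Rightarrow> (nat \<Rightarrow> real) set" where
  "Rm m = {..<m} \<rightarrow>\<^sub>E UNIV"

definition averaging_operator :: "nat \<Rightarrow> ((nat \<Rightarrow> real) \<Rightarrow> real) \<Rightarrow> bool" where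
  "averaging_operator m F \<longleftrightarrow>
     continuous_map (powertop_real {..<m}) euclideanreal F \<and>
     F (\<lambda>i\<in>{..<m}. 0) = 0 \<and> F (\<lambda>i\<in>{..<m}. 1) = 1 \<and>
     (\<forall>x\<in>Rm m. \<forall>t. F (\<lambda>i\<in>{..<m}. t * x i) = t * F x) \<and>
     (\<forall>x\<in>Rm m. \<forall>t. F (\<lambda>i\<in>{..<m}. t + x i) = t + F x) \<and>
     (\<forall>x\<in>Rm m. (\<exists>i<m. \<exists>j<m. x i \<noteq> x j) \<longrightarrow> F x < Max (x ` {..<m})) \<and>
     (\<forall>x\<in>Rm m. \<forall>j<m. \<forall>s\<ge>x j. F x \<le> F (x(j := s)))"

definition permutation_invariant :: "nat \<Rightarrow> ((nat \<Rightarrow> real) \<Rightarrow> real) \<Rightarrow> bool" where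
  "permutation_invariant m F \<longleftrightarrow>
     (\<forall>\<tau>. \<tau> permutes {..<m} \<longrightarrow> (\<forall>x\<in>Rm m. F x = F (\<lambda>i\<in>{..<m}. x (\<tau> i))))"

definition tree :: "nat \<Rightarrow> nat list set" where
  "tree m = {x. set x \<subseteq> {..<m}}"

text \<open>
  A branch is a digit sequence indexed from 0: its value at \<open>k\<close> is the digit \<open>a_{k+1}\<close>.
\<close>

definition branches :: "nat \<Rightarrow> (nat \<Rightarrow> nat) set" where
  "branches m = {a. \<forall>k. a k < m}"

definition branch_vertex :: "(nat \<Rightarrow> nat) \<Rightarrow> nat \<Rightarrow> nat list" where
  "branch_vertex a k = map a [0..<k]"

definition psi :: "nat \<Rightarrow> (nat \<Rightarrow> nat) \<Rightarrow> real" where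
  "psi m a = (\<Sum>k. real (a k) / real m ^ Suc k)"

definition superharmonic :: "nat \<Rightarrow> ((nat \<Rightarrow> real) \<Rightarrow> real) \<Rightarrow> (nat list \<Rightarrow> real) \<Rightarrow> bool" where
  "superharmonic m F w \<longleftrightarrow> (\<forall>x\<in>tree m. w x \<ge> F (\<lambda>i\<in>{..<m}. w (x @ [i])))"

text \<open>
  The lower limit and the infimum below are taken in the extended reals, so that neither
  needs a boundedness or nonemptiness side condition. Values of \<open>w\<close> outside the tree are irrelevant.
\<close>

definition upper_class ::
    "nat \<Rightarrow> ((nat \<Rightarrow> real) \<Rightarrow> real) \<Rightarrow> real set \<Rightarrow> (nat list \<Rightarrow> real) set" where
  "upper_class m F I =
     {w. superharmonic m F w \<and>
         (\<forall>a\<in>branches m.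
            liminf (\<lambda>k. ereal (w (branch_vertex a k))) \<ge> ereal (indicat_real I (psi m a)))}"

definition harmonic_measure :: "nat \<Rightarrow> ((nat \<Rightarrow> real) \<Rightarrow> real) \<Rightarrow> real set \<Rightarrow> ereal" where
  "harmonic_measure m F I = (INF w\<in>upper_class m F I. ereal (w []))"

end

theory Submission imports Defs begin

text \<open>
  Lower bound: an averaging operator is at least the minimum of its arguments, so from every vertex
  one can descend to a successor at which a superharmonic \<open>w\<close> is no larger; along the resulting
  branch the lower limit is at most \<open>w []\<close>.

  Upper bound: if \<open>|I| < m\<^bsup>-n\<^esup>\<close>, then the branches that \<open>\<psi>\<close> maps into \<open>I\<close> pass through at most
  two vertices of level \<open>n\<close>. Adding up masses \<open>\<kappa>\<^bsup>n-|x|\<^esup>\<close> over these vertices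
  gives an admissible \<open>w\<close>, because \<open>F y \<le> \<kappa> (y\<^sub>1 + \<dots> + y\<^sub>m)\<close> for \<open>y \<ge> 0\<close>, and
  \<open>w [] \<le> 2 \<kappa>\<^bsup>n\<^esup>\<close>.
\<close>

section \<open>Averaging operators and the lower bound\<close>

lemma averaging_operator_const:
  assumes "averaging_operator m F"
  shows "F (\<lambda>i\<in>{..<m}. c) = c"
proof -
  have "(\<lambda>i\<in>{..<m}. 0) \<in> Rm m"
    by (auto simp: Rm_def)
  then have "F (\<lambda>i\<in>{..<m}. c + (\<lambda>i\<in>{..<m}. 0) i) = c + F (\<lambda>i\<in>{..<m}. 0)"
    using assms unfolding averaging_operator_def by blast
  moreover have "(\<lambda>i\<in>{..<m}. c + (\<lambda>i\<in>{..<m}. 0) i) = (\<lambda>i\<in>{..<m}. c)"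
    by (auto simp: restrict_def)
  ultimately show ?thesis
    using assms unfolding averaging_operator_def by simp
qed

text \<open>The maximum axiom applied to \<open>-y\<close>, together with homogeneity for the factor
  -1, becomes a minimum principle. It says nothing when all coordinates agree; then \<open>y\<close>
  is constant and \<open>F y\<close> is that constant.\<close>

lemma averaging_operator_ge_some_argument:
  assumes F: "averaging_operator m F" and "m > 0" and y: "y \<in> Rm m"
  shows "\<exists>i<m. y i \<le> F y"
proof (cases "\<exists>i<m. \<exists>j<m. y i \<noteq> y j")
  case True
  let ?z = "\<lambda>i\<in>{..<m}. - 1 * y i"
  have "?z \<in> Rm m"
    by (auto simp: Rm_def)
  moreover have "\<exists>i<m. \<exists>j<m. ?z i \<noteq> ?z j"
    using True by auto
  ultimately have "F ?z < Max (?z ` {..<m})"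
    using F unfolding averaging_operator_def by blast
  moreover have "F ?z = - 1 * F y"
    using F y unfolding averaging_operator_def by blast
  moreover have "Max (?z ` {..<m}) \<in> ?z ` {..<m}"
    using \<open>m > 0\<close> by (intro Max_in) auto
  ultimately obtain i where "i < m" "- F y < - y i"
    by auto
  then show ?thesis by (auto intro!: exI[of _ i])
next
  case False
  have "y = (\<lambda>i\<in>{..<m}. y 0)"
  proof
    fix i
    have "y i = y 0" if "i < m"
      using False \<open>m > 0\<close> that by blast
    moreover have "y i = undefined" if "\<not> i < m"
      using y that by (simp add: Rm_def PiE_def extensional_def)
    ultimately show "y i = (\<lambda>i\<in>{..<m}. y 0) i"
      by simp
  qed
  then have "F y = y 0"
    using averaging_operator_const[OF F, of "y 0"] by metis
  then show ?thesis using \<open>m > 0\<close> by auto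
qed

lemma harmonic_measure_nonneg:
  assumes F: "averaging_operator m F" and "m > 0"
  shows "0 \<le> harmonic_measure m F I"
  unfolding harmonic_measure_def
proof (rule INF_greatest)
  fix w assume w: "w \<in> upper_class m F I"
  define d where "d x = (SOME i. i < m \<and> w (x @ [i]) \<le> w x)" for x
  have d: "d x < m \<and> w (x @ [d x]) \<le> w x" if "x \<in> tree m" for x
  proof -
    let ?y = "\<lambda>i\<in>{..<m}. w (x @ [i])"
    have "?y \<in> Rm m"
      by (auto simp: Rm_def)
    from averaging_operator_ge_some_argument[OF F \<open>m > 0\<close> this]
    obtain i where "i < m" "w (x @ [i]) \<le> F ?y"
      by auto
    moreover have "F ?y \<le> w x"
      using w that by (auto simp: upper_class_def superharmonic_def)
    ultimately have "\<exists>i. i < m \<and> w (x @ [i]) \<le> w x"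
      by (intro exI[of _ i]) auto
    then show ?thesis
      unfolding d_def by (rule someI_ex)
  qed
  \<comment> \<open>Greedy descent: the digits \<open>a\<close> are the choices made along
    \<open>s\<close>, so the vertices of the branch \<open>a\<close> are exactly the
    \<open>s k\<close>. Since \<open>s\<close> stays in the tree, the arbitrary values of
    \<open>d\<close> elsewhere do no harm.\<close>
  define s where "s = rec_nat [] (\<lambda>_ x. x @ [d x])"
  define a where "a k = d (s k)" for k
  have s: "s 0 = []" "s (Suc k) = s k @ [d (s k)]" for k
    by (auto simp: s_def)
  have tree: "s k \<in> tree m" for k
    by (induction k) (use d in \<open>auto simp: s tree_def\<close>)
  have "a \<in> branches m"
    using d[OF tree] by (auto simp: a_def branches_def)
  moreover have vertex: "branch_vertex a k = s k" for k
    by (induction k) (auto simp: s a_def branch_vertex_def)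
  ultimately have "ereal (indicat_real I (psi m a)) \<le> liminf (\<lambda>k. ereal (w (s k)))"
    using w by (auto simp: upper_class_def simp flip: vertex)
  moreover have "w (s k) \<le> w []" for k
  proof (induction k)
    case (Suc k)
    then show ?case using d[OF tree[of k]] by (simp add: s)
  qed (simp add: s)
  then have "liminf (\<lambda>k. ereal (w (s k))) \<le> liminf (\<lambda>k::nat. ereal (w []))"
    by (intro Liminf_mono) auto
  then have "liminf (\<lambda>k. ereal (w (s k))) \<le> ereal (w [])"
    by (simp add: Liminf_const)
  moreover have "0 \<le> ereal (indicat_real I (psi m a))"
    by simp
  ultimately show "0 \<le> ereal (w [])"
    by (metis order_trans)
qed

section \<open>A linear upper bound for \<open>F\<close> on nonnegative arguments\<close>

text \<open>Conjugation with the transposition of 0 and \<open>k\<close> carries the increment bound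
  from coordinate 0 to coordinate \<open>k\<close>.\<close>

lemma permutation_invariant_upd_le:
  assumes perm: "permutation_invariant m F"
    and upd: "\<And>x c. x \<in> Rm m \<Longrightarrow> c > 0 \<Longrightarrow> F (x(0 := x 0 + c)) \<le> F x + c * \<kappa>"
    and x: "x \<in> Rm m" and "k < m" and "c \<ge> 0"
  shows "F (x(k := x k + c)) \<le> F x + c * \<kappa>"
proof (cases "c = 0")
  case False
  let ?t = "Transposition.transpose 0 k"
  have t: "?t permutes {..<m}"
    using \<open>k < m\<close> by (intro permutes_swap_id) auto
  let ?y = "\<lambda>i\<in>{..<m}. x (?t i)"
  have y: "?y \<in> Rm m"
    by (auto simp: Rm_def)
  have xk: "x(k := x k + c) \<in> Rm m"
    using x \<open>k < m\<close> by (auto simp: Rm_def PiE_def extensional_def)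
  have "F (x(k := x k + c)) = F (\<lambda>i\<in>{..<m}. (x(k := x k + c)) (?t i))"
    using perm t xk unfolding permutation_invariant_def by blast
  also have "(\<lambda>i\<in>{..<m}. (x(k := x k + c)) (?t i)) = ?y(0 := ?y 0 + c)"
    using \<open>k < m\<close> by (auto simp: fun_eq_iff Transposition.transpose_def)
  also have "F \<dots> \<le> F ?y + c * \<kappa>"
    using upd[OF y] False \<open>c \<ge> 0\<close> by simp
  also have "F ?y = F x"
    using perm t x unfolding permutation_invariant_def by metis
  finally show ?thesis .
qed simp

text \<open>Start from the zero vector, where \<open>F\<close> vanishes, and raise the coordinates
  to \<open>y i\<close> one at a time; raising coordinate \<open>k\<close> costs at most
  \<open>\<kappa> * y k\<close>. The vector \<open>z k\<close> is the state after \<open>k\<close>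
  such moves.\<close>

lemma averaging_operator_le_sum:
  assumes F: "averaging_operator m F" and perm: "permutation_invariant m F"
    and upd: "\<And>x c. x \<in> Rm m \<Longrightarrow> c > 0 \<Longrightarrow> F (x(0 := x 0 + c)) \<le> F x + c * \<kappa>"
    and y: "\<And>i. i < m \<Longrightarrow> y i \<ge> 0"
  shows "F (\<lambda>i\<in>{..<m}. y i) \<le> \<kappa> * (\<Sum>i<m. y i)"
proof -
  define z where "z k = (\<lambda>i\<in>{..<m}. if i < k then y i else 0)" for k
  have "F (z k) \<le> \<kappa> * (\<Sum>i<k. y i)" if "k \<le> m" for k
    using that
  proof (induction k)
    case 0
    then show ?case
      using averaging_operator_const[OF F, of 0] by (simp add: z_def restrict_def)
  next
    case (Suc k)
    have "z k \<in> Rm m"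
      by (auto simp: Rm_def z_def)
    moreover have "z (Suc k) = (z k)(k := z k k + y k)"
      using Suc.prems by (auto simp: z_def fun_eq_iff)
    moreover have "F ((z k)(k := z k k + y k)) \<le> F (z k) + y k * \<kappa>"
      by (rule permutation_invariant_upd_le[OF perm upd \<open>z k \<in> Rm m\<close>]) (use y Suc.prems in auto)
    ultimately have "F (z (Suc k)) \<le> F (z k) + y k * \<kappa>"
      by metis
    then show ?case
      using Suc by (simp add: algebra_simps)
  qed
  moreover have "z m = (\<lambda>i\<in>{..<m}. y i)"
    by (auto simp: z_def fun_eq_iff)
  ultimately show ?thesis by force
qed

section \<open>Base-m expansions and the map \<open>psi\<close>\<close>

text \<open>Horner scheme for the integer with base-m digits \<open>a 0\<close>, ...,
  \<open>a (n-1)\<close>, most significant first. It turns questions about vertices of level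
  \<open>n\<close> into arithmetic.\<close>

definition vertex_value :: "nat \<Rightarrow> (nat \<Rightarrow> nat) \<Rightarrow> nat \<Rightarrow> nat" where
  "vertex_value m a n = rec_nat 0 (\<lambda>k v. m * v + a k) n"

lemma vertex_value_simps [simp]:
  "vertex_value m a 0 = 0"
  "vertex_value m a (Suc n) = m * vertex_value m a n + a n"
  by (auto simp: vertex_value_def)

text \<open>Uniqueness of base-m digits: reduction mod \<open>m\<close> recovers the last one, and
  the rest follows by induction.\<close>

lemma vertex_value_inject:
  assumes "a \<in> branches m" "b \<in> branches m" "vertex_value m a n = vertex_value m b n"
  shows "branch_vertex a n = branch_vertex b n"
  using assms(3)
proof (induction n)
  case (Suc n)
  have lt: "a n < m" "b n < m"
    using assms by (auto simp: branches_def)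
  have eq: "m * vertex_value m a n + a n = m * vertex_value m b n + b n"
    using Suc.prems by simp
  from arg_cong[OF this, of "\<lambda>k. k mod m"] have "a n = b n"
    using lt by simp
  then show ?case
    using eq lt Suc.IH by (auto simp: branch_vertex_def)
qed (simp add: branch_vertex_def)

lemma psi_bounds_and_unfold:
  assumes "m \<ge> 2" and a: "a \<in> branches m"
  shows "0 \<le> psi m a" "psi m a \<le> 1"
    and "psi m a = (real (a 0) + psi m (\<lambda>k. a (Suc k))) / real m"
proof -
  \<comment> \<open>The dominating series is that of the branch with all digits m - 1, whose sum is
    1.\<close>
  have "(\<lambda>k. (1 / real m) ^ k) sums (1 / (1 - 1 / real m))"
    using \<open>m \<ge> 2\<close> by (intro geometric_sums) auto
  then have "(\<lambda>k. (real m - 1) / real m * (1 / real m) ^ k) sums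
      ((real m - 1) / real m * (1 / (1 - 1 / real m)))"
    by (rule sums_mult)
  moreover have "(real m - 1) / real m * (1 / (1 - 1 / real m)) = 1"
    using \<open>m \<ge> 2\<close> by (simp add: field_simps)
  ultimately have geo: "(\<lambda>k. (real m - 1) / real m * (1 / real m) ^ k) sums 1"
    by (simp only:)
  have le: "real (b k) / real m ^ Suc k \<le> (real m - 1) / real m * (1 / real m) ^ k"
    if "b \<in> branches m" for b k
  proof -
    have "real (b k) \<le> real m - 1"
      using that \<open>m \<ge> 2\<close> by (auto simp: branches_def less_eq_Suc_le dest!: spec[of _ k])
    then show ?thesis
      using \<open>m \<ge> 2\<close> by (simp add: power_one_over divide_right_mono)
  qed
  have summ: "summable (\<lambda>k. real (b k) / real m ^ Suc k)" if "b \<in> branches m" for b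
    by (rule summable_comparison_test'[OF sums_summable[OF geo]]) (use le[OF that] in auto)
  show "0 \<le> psi m a"
    unfolding psi_def by (intro suminf_nonneg summ a) auto
  show "psi m a \<le> 1"
    unfolding psi_def by (rule sums_le[OF le[OF a] summable_sums[OF summ[OF a]] geo])
  have shift: "(\<lambda>k. a (Suc k)) \<in> branches m"
    using a by (auto simp: branches_def)
  have "psi m a = real (a 0) / real m + (\<Sum>k. real (a (Suc k)) / real m ^ Suc (Suc k))"
    unfolding psi_def using suminf_split_head[OF summ[OF a]] by simp
  also have "(\<lambda>k. real (a (Suc k)) / real m ^ Suc (Suc k)) =
      (\<lambda>k. real (a (Suc k)) / real m ^ Suc k / real m)"
    by (simp add: fun_eq_iff)
  also have "(\<Sum>k. real (a (Suc k)) / real m ^ Suc k / real m) =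
      (\<Sum>k. real (a (Suc k)) / real m ^ Suc k) / real m"
    by (rule suminf_divide[OF summ[OF shift]])
  finally show "psi m a = (real (a 0) + psi m (\<lambda>k. a (Suc k))) / real m"
    by (simp add: psi_def add_divide_distrib)
qed

text \<open>Multiplying by \<open>m ^ n\<close> shifts the first \<open>n\<close> digits in front of
  the point; what remains is \<open>psi\<close> of the tail, which lies in [0,1]. The value 1 occurs
  for a tail of digits m - 1, so the upper bound is not strict.\<close>

lemma psi_vertex_value_bounds:
  assumes "m \<ge> 2" and a: "a \<in> branches m"
  shows "real (vertex_value m a n) \<le> real m ^ n * psi m a"
    and "real m ^ n * psi m a \<le> real (vertex_value m a n) + 1"
proof -
  have shift: "(\<lambda>k. a (k + n)) \<in> branches m" for n
    using a by (auto simp: branches_def)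
  have "real m ^ n * psi m a = real (vertex_value m a n) + psi m (\<lambda>k. a (k + n))"
  proof (induction n)
    case (Suc n)
    have "real m ^ Suc n * psi m a = real m * (real m ^ n * psi m a)"
      by simp
    also have "\<dots> = real m * real (vertex_value m a n) + real m * psi m (\<lambda>k. a (k + n))"
      unfolding Suc by (simp add: algebra_simps)
    also have "real m * psi m (\<lambda>k. a (k + n)) = real (a n) + psi m (\<lambda>k. a (k + Suc n))"
      using psi_bounds_and_unfold(3)[OF \<open>m \<ge> 2\<close> shift[of n]] \<open>m \<ge> 2\<close> by (simp add: field_simps)
    finally show ?case by simp
  qed simp
  then show "real (vertex_value m a n) \<le> real m ^ n * psi m a"
    "real m ^ n * psi m a \<le> real (vertex_value m a n) + 1"
    using psi_bounds_and_unfold(1,2)[OF \<open>m \<ge> 2\<close> shift[of n]] by auto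
qed

section \<open>A short interval meets at most two vertices of level n\<close>

lemma diff_le_measure_interval:
  fixes I :: "real set"
  assumes "is_interval I" "bounded I" "p \<in> I" "q \<in> I"
  shows "q - p \<le> measure lborel I"
proof (cases "p \<le> q")
  case True
  have "{p..q} \<subseteq> I"
    using assms mem_is_interval_1_I[of I p q] by auto
  moreover have "I \<in> fmeasurable lborel"
    using assms real_interval_borel_measurable emeasure_bounded_finite by (auto simp: fmeasurable_def)
  ultimately have "measure lborel {p..q} \<le> measure lborel I"
    by (intro measure_mono_fmeasurable) auto
  then show ?thesis using True by simp
next
  case False
  then show ?thesis
    using measure_nonneg[of lborel I] by linarith
qed

text \<open>The hypothesis is used with \<open>j\<close> the least element \<open>l\<close> of
  \<open>K\<close>, which confines \<open>K\<close> to \<open>{l, l + 1}\<close>.\<close>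

lemma card_le_2_if_diff_le_1:
  fixes K :: "nat set"
  assumes "\<And>j k. j \<in> K \<Longrightarrow> k \<in> K \<Longrightarrow> k \<le> j + 1"
  shows "finite K" "card K \<le> 2"
proof -
  have "\<exists>l. K \<subseteq> {l, l + 1}"
  proof (cases "K = {}")
    case False
    define l where "l = (LEAST l. l \<in> K)"
    have "l \<in> K"
      using False unfolding l_def by (metis LeastI ex_in_conv)
    moreover have "l \<le> k" if "k \<in> K" for k
      using that unfolding l_def by (rule Least_le)
    ultimately have "K \<subseteq> {l, l + 1}"
      using assms by (fastforce simp: le_Suc_eq)
    then show ?thesis by blast
  qed simp
  then obtain l where l: "K \<subseteq> {l, l + 1}" by blast
  then show "finite K"
    by (rule finite_subset) simp
  have "card K \<le> card {l, l + 1}"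
    using l by (intro card_mono) auto
  then show "card K \<le> 2" by simp
qed

text \<open>After scaling by \<open>m ^ n\<close>, two points of \<open>I\<close> differ by less
  than 1, and each vertex value lies within 1 below its scaled point. So two vertex values differ by
  less than 2, hence by at most 1. Strictness of \<open>small\<close> matters: a closed interval of
  length exactly \<open>1 / m ^ n\<close> can meet three vertices, as its endpoints have two
  expansions.\<close>

lemma hit_vertices_card_le_2:
  assumes "m \<ge> 2" and I: "is_interval I" "bounded I"
    and small: "measure lborel I < 1 / real m ^ n"
  defines "S \<equiv> (\<lambda>a. branch_vertex a n) ` {a \<in> branches m. psi m a \<in> I}"
  shows "finite S" "card S \<le> 2"
proof -
  define A where "A = {a \<in> branches m. psi m a \<in> I}"
  define K where "K = (\<lambda>a. vertex_value m a n) ` A"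
  have "k \<le> j + 1" if jk: "j \<in> K" "k \<in> K" for j k
  proof -
    obtain a b where a: "a \<in> A" "j = vertex_value m a n" and b: "b \<in> A" "k = vertex_value m b n"
      using jk by (auto simp: K_def)
    have "psi m b - psi m a \<le> measure lborel I"
      using a b by (intro diff_le_measure_interval I) (auto simp: A_def)
    with small have "psi m b - psi m a < 1 / real m ^ n"
      by simp
    then have "real m ^ n * psi m b - real m ^ n * psi m a < 1"
      using \<open>m \<ge> 2\<close> by (simp add: field_simps)
    moreover have "real k \<le> real m ^ n * psi m b" "real m ^ n * psi m a \<le> real j + 1"
      using a b psi_vertex_value_bounds[OF \<open>m \<ge> 2\<close>] by (auto simp: A_def)
    ultimately have "real k < real (j + 2)" by simp
    then show ?thesis by linarith
  qed
  note K = card_le_2_if_diff_le_1[OF this]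
  \<comment> \<open>By \<open>vertex_value_inject\<close> the vertex does not depend on the chosen
    branch, so \<open>g\<close> maps \<open>K\<close> onto a set containing \<open>S\<close>, and
    the bound on \<open>card K\<close> transfers.\<close>
  define g where "g k = branch_vertex (SOME a. a \<in> A \<and> vertex_value m a n = k) n" for k
  have "S \<subseteq> g ` K"
  proof
    fix v assume "v \<in> S"
    then obtain a where a: "a \<in> A" "v = branch_vertex a n"
      by (auto simp: S_def A_def)
    let ?b = "SOME b. b \<in> A \<and> vertex_value m b n = vertex_value m a n"
    have "?b \<in> A \<and> vertex_value m ?b n = vertex_value m a n"
      by (rule someI[of _ a]) (use a in auto)
    then have "g (vertex_value m a n) = v"
      using a vertex_value_inject[of ?b m a n] by (auto simp: A_def g_def)
    then show "v \<in> g ` K"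
      using a unfolding K_def by (metis imageI)
  qed
  then show "finite S" "card S \<le> 2"
    using finite_surj[OF K(1)] surj_card_le[OF K(1)] K(2) by (blast, fastforce)
qed

section \<open>The barrier function and the upper bound at level n\<close>

text \<open>For \<open>S\<close> at level \<open>n\<close>, the cardinality counts the vertices of
  \<open>S\<close> that descend from \<open>x\<close>. From level \<open>n\<close> on the value is
  inherited from the ancestor of level \<open>n\<close>, so superharmonicity there is the identity
  for constants.\<close>

definition barrier :: "nat \<Rightarrow> real \<Rightarrow> nat list set \<Rightarrow> nat list \<Rightarrow> real" where
  "barrier n \<kappa> S x = (if length x < n then \<kappa> ^ (n - length x) * real (card {v \<in> S. take (length x) v = x})
     else if take n x \<in> S then 1 else 0)"

lemma barrier_in_upper_class:
  assumes F: "averaging_operator m F" and perm: "permutation_invariant m F"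
    and upd: "\<And>x c. x \<in> Rm m \<Longrightarrow> c > 0 \<Longrightarrow> F (x(0 := x 0 + c)) \<le> F x + c * \<kappa>"
    and "0 < \<kappa>" and "finite S" and S: "S = (\<lambda>a. branch_vertex a n) ` {a \<in> branches m. psi m a \<in> I}"
  shows "barrier n \<kappa> S \<in> upper_class m F I"
proof -
  let ?w = "barrier n \<kappa> S"
  have len: "length v = n" if "v \<in> S" for v
    using that by (auto simp: S branch_vertex_def)
  \<comment> \<open>The counting formula persists at level \<open>n\<close>, where the set is
    \<open>{x}\<close> or empty; thus children of level \<open>n\<close> need no separate
    treatment.\<close>
  have below: "?w x = \<kappa> ^ (n - length x) * real (card {v \<in> S. take (length x) v = x})"
    if "length x \<le> n" for x
  proof (cases "length x < n")
    case False
    with that have "length x = n" by simp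
    have "take n v = v" if "v \<in> S" for v
      using len[OF that] by simp
    then have "{v \<in> S. take n v = x} = (if x \<in> S then {x} else {})"
      by auto
    then show ?thesis
      unfolding barrier_def \<open>length x = n\<close> using \<open>length x = n\<close> by auto
  qed (simp add: barrier_def)
  have "F (\<lambda>i\<in>{..<m}. ?w (x @ [i])) \<le> ?w x" if "x \<in> tree m" for x
  proof (cases "length x < n")
    case False
    then have "(\<lambda>i\<in>{..<m}. ?w (x @ [i])) = (\<lambda>i\<in>{..<m}. ?w x)"
      by (auto simp: barrier_def fun_eq_iff)
    then show ?thesis
      using averaging_operator_const[OF F] by simp
  next
    case True
    let ?T = "\<lambda>i. {v \<in> S. take (Suc (length x)) v = x @ [i]}"
    have child: "?w (x @ [i]) = \<kappa> ^ (n - Suc (length x)) * real (card (?T i))" for i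
      using below[of "x @ [i]"] True by simp
    have "F (\<lambda>i\<in>{..<m}. ?w (x @ [i])) \<le> \<kappa> * (\<Sum>i<m. ?w (x @ [i]))"
      using \<open>0 < \<kappa>\<close> by (intro averaging_operator_le_sum[OF F perm upd]) (auto simp: child)
    \<comment> \<open>The factor \<open>\<kappa>\<close> from the linear bound makes up for the
      exponent of the children being smaller by one.\<close>
    also have "\<dots> = \<kappa> ^ (n - length x) * (\<Sum>i<m. real (card (?T i)))"
      unfolding child sum_distrib_left[symmetric] mult.assoc[symmetric] power_Suc[symmetric]
      using True by (simp only: Suc_diff_Suc)
    also have "(\<Sum>i<m. real (card (?T i))) = real (card (\<Union>i<m. ?T i))"
      using \<open>finite S\<close> by (subst card_UN_disjoint) auto
    also have "\<kappa> ^ (n - length x) * \<dots> \<le> \<kappa> ^ (n - length x) * real (card {v \<in> S. take (length x) v = x})"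
    proof -
      have "(\<Union>i<m. ?T i) \<subseteq> {v \<in> S. take (length x) v = x}"
      proof clarify
        fix v i assume "take (Suc (length x)) v = x @ [i]"
        from arg_cong[OF this, of "take (length x)"] show "take (length x) v = x"
          by simp
      qed
      then show ?thesis
        using \<open>finite S\<close> \<open>0 < \<kappa>\<close> by (intro mult_left_mono) (auto intro!: card_mono)
    qed
    finally show ?thesis
      using True by (simp only: below less_imp_le)
  qed
  moreover have "ereal (indicat_real I (psi m a)) \<le> liminf (\<lambda>k. ereal (?w (branch_vertex a k)))"
    if "a \<in> branches m" for a
  proof (rule Liminf_bounded)
    \<comment> \<open>From level \<open>n\<close> on, the barrier is constant along the branch: 1 if
      the branch passes through \<open>S\<close>, in particular if \<open>psi m a\<close> is in
      \<open>I\<close>, and 0 otherwise.\<close>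
    show "\<forall>\<^sub>F k in sequentially. ereal (indicat_real I (psi m a)) \<le> ereal (?w (branch_vertex a k))"
      using eventually_ge_at_top[of n]
    proof eventually_elim
      case (elim k)
      then have "take n (branch_vertex a k) = branch_vertex a n"
        by (simp add: branch_vertex_def take_map)
      moreover have "branch_vertex a n \<in> S" if "psi m a \<in> I"
        using that \<open>a \<in> branches m\<close> by (auto simp: S)
      ultimately show ?case
        using elim by (auto simp: barrier_def indicator_def branch_vertex_def)
    qed
  qed
  ultimately show ?thesis
    by (auto simp: upper_class_def superharmonic_def)
qed

lemma harmonic_measure_le_2_power:
  assumes "m \<ge> 2" and F: "averaging_operator m F" and perm: "permutation_invariant m F"
    and upd: "\<And>x c. x \<in> Rm m \<Longrightarrow> c > 0 \<Longrightarrow> F (x(0 := x 0 + c)) \<le> F x + c * \<kappa>"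
    and "0 < \<kappa>" and I: "is_interval I" "bounded I"
    and small: "measure lborel I < 1 / real m ^ n"
  shows "harmonic_measure m F I \<le> ereal (2 * \<kappa> ^ n)"
proof -
  let ?S = "(\<lambda>a. branch_vertex a n) ` {a \<in> branches m. psi m a \<in> I}"
  note S = hit_vertices_card_le_2[OF \<open>m \<ge> 2\<close> I small]
  have "harmonic_measure m F I \<le> ereal (barrier n \<kappa> ?S [])"
    unfolding harmonic_measure_def
    by (intro INF_lower barrier_in_upper_class[OF F perm upd \<open>0 < \<kappa>\<close> S(1) refl])
  also have "barrier n \<kappa> ?S [] \<le> 2 * \<kappa> ^ n"
    using S(2) \<open>0 < \<kappa>\<close> by (auto simp: barrier_def)
  finally show ?thesis by simp
qed

text \<open>Witnessed by the constant 1. It serves intervals of length 1, which satisfy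
  \<open>|I| < 1 / m ^ n\<close> for no \<open>n\<close>.\<close>

lemma harmonic_measure_le_1:
  assumes F: "averaging_operator m F"
  shows "harmonic_measure m F I \<le> 1"
proof -
  have "(\<lambda>_. 1) \<in> upper_class m F I"
    by (simp add: upper_class_def superharmonic_def averaging_operator_const[OF F]
        Liminf_const indicator_def del: restrict_apply)
  then have "harmonic_measure m F I \<le> ereal 1"
    unfolding harmonic_measure_def by (rule INF_lower)
  then show ?thesis by (simp add: one_ereal_def)
qed

section \<open>Choice of the level n\<close>

theorem corollary1p2:
  fixes m :: nat and F :: "(nat \<Rightarrow> real) \<Rightarrow> real" and \<kappa> \<gamma> :: real and I :: "real set"
  assumes "m \<ge> 3"
    and "averaging_operator m F"
    and "permutation_invariant m F"
    and "0 < \<kappa>" and "\<kappa> < 1"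
    and "\<And>x c. x \<in> Rm m \<Longrightarrow> c > 0 \<Longrightarrow> F (x(0 := x 0 + c)) \<le> F x + c * \<kappa>"
    and "I \<subseteq> {0..1}" and "is_interval I"
    and "0 \<le> \<gamma>" and "\<gamma> \<le> - log (real m) \<kappa>"
  shows "0 \<le> harmonic_measure m F I \<and>
         harmonic_measure m F I \<le> ereal (2 * (real m * measure lborel I) powr \<gamma>)"
proof
  show "0 \<le> harmonic_measure m F I"
    using \<open>m \<ge> 3\<close> by (intro harmonic_measure_nonneg[OF assms(2)]) simp
  have "bounded I"
    using \<open>I \<subseteq> {0..1}\<close> bounded_subset bounded_closed_interval by blast
  have *: "harmonic_measure m F I \<le> ereal (2 * \<kappa> ^ n)" if "measure lborel I < 1 / real m ^ n" for n
    by (rule harmonic_measure_le_2_power[OF _ assms(2,3,6,4,8) \<open>bounded I\<close> that])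
      (use \<open>m \<ge> 3\<close> in auto)
  define L where "L = measure lborel I"
  show "harmonic_measure m F I \<le> ereal (2 * (real m * measure lborel I) powr \<gamma>)"
  \<comment> \<open>Here \<open>0 powr \<gamma>\<close> is 0, even for \<open>\<gamma> = 0\<close>,
    so the measure has to vanish exactly; the level bound holds for every \<open>n\<close>, and
    \<open>n\<close> tends to infinity.\<close>
  proof (cases "L = 0")
    case True
    have lim: "(\<lambda>n. ereal (2 * \<kappa> ^ n)) \<longlonglongrightarrow> ereal (2 * 0)"
      using \<open>0 < \<kappa>\<close> \<open>\<kappa> < 1\<close> by (intro tendsto_intros LIMSEQ_power_zero) auto
    have "harmonic_measure m F I \<le> ereal (2 * \<kappa> ^ n)" for n
      using True \<open>m \<ge> 3\<close> by (intro *) (simp add: L_def)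
    then have "harmonic_measure m F I \<le> ereal (2 * 0)"
      by (intro LIMSEQ_le_const[OF lim]) blast
    then show ?thesis using True by (simp add: L_def)
  next
    case False
    then have "L > 0"
      using measure_nonneg[of lborel I] unfolding L_def by linarith
    show ?thesis
    proof (cases "L < 1")
      case True
      have "\<exists>n. 1 / real m ^ n \<le> L"
      proof -
        obtain n where "(1 / real m) ^ n < L"
          using real_arch_pow_inv[OF \<open>L > 0\<close>, of "1 / real m"] \<open>m \<ge> 3\<close> by auto
        then show ?thesis
          by (intro exI[of _ n]) (simp add: power_one_over)
      qed
      \<comment> \<open>The least such \<open>n\<close> is positive because \<open>L < 1\<close>.
        Its predecessor \<open>k\<close> is the deepest level with \<open>L < 1 / m ^ k\<close>, and
        \<open>1 / m ^ k \<le> m * L\<close>; this is the source of the factor \<open>m\<close> in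
        the bound.\<close>
      then obtain n where n: "1 / real m ^ n \<le> L" "\<And>k. k < n \<Longrightarrow> \<not> 1 / real m ^ k \<le> L"
        using exists_least_iff[of "\<lambda>n. 1 / real m ^ n \<le> L"] by blast
      with True obtain k where k: "n = Suc k"
        by (cases n) auto
      have "\<kappa> ^ k = real m powr (log (real m) \<kappa> * real k)"
        using \<open>m \<ge> 3\<close> \<open>0 < \<kappa>\<close> by (simp add: powr_realpow flip: powr_powr)
      \<comment> \<open>The bound on \<open>\<gamma>\<close> reads
        \<open>log m \<kappa> \<le> - \<gamma>\<close>.\<close>
      also have "\<dots> \<le> real m powr (- real k * \<gamma>)"
        using \<open>m \<ge> 3\<close> mult_left_mono[OF assms(10), of "real k"]
        by (intro powr_mono) (auto simp: mult.commute)
      also have "\<dots> = (1 / real m ^ k) powr \<gamma>"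
        using \<open>m \<ge> 3\<close> by (simp add: powr_minus_divide powr_realpow powr_divide flip: powr_powr)
      also have "\<dots> \<le> (real m * L) powr \<gamma>"
        using n(1) \<open>m \<ge> 3\<close> \<open>0 \<le> \<gamma>\<close> unfolding k by (intro powr_mono2) (auto simp: field_simps)
      finally have "ereal (2 * \<kappa> ^ k) \<le> ereal (2 * (real m * L) powr \<gamma>)"
        by simp
      moreover have "harmonic_measure m F I \<le> ereal (2 * \<kappa> ^ k)"
        using n(2)[of k] k by (intro *) (simp add: L_def)
      ultimately show ?thesis
        unfolding L_def by (rule order_trans[rotated])
    next
      case False
      \<comment> \<open>Here the right-hand side is at least 2, so the trivial bound 1
        suffices.\<close>
      have "1 \<le> real m * L"
        using False \<open>m \<ge> 3\<close> mult_mono[of 1 "real m" 1 L] by simp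
      then have "1 \<le> 2 * (real m * L) powr \<gamma>"
        using ge_one_powr_ge_zero[of "real m * L" \<gamma>] \<open>0 \<le> \<gamma>\<close> by simp
      then have "1 \<le> ereal (2 * (real m * L) powr \<gamma>)"
        by (simp add: one_ereal_def)
      then show ?thesis
        using harmonic_measure_le_1[OF assms(2)] unfolding L_def by (rule order_trans[rotated])
    qed
  qed
qed

end
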